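(* Let $n\ge1$, $\alpha\in\mathbb{R}\setminus\pi\mathbb{Z}$, $m\ge2$, and let $1\le p_1,\dots,p_m\le\infty$ satisfy $\frac1p=\frac1{p_1}+\cdots+\frac1{p_m}$ for some $0<p\le\infty$. Define the twisted product $$\Pi_\alpha^{(m)}(f_1,\dots,f_m):=M_\alpha^{-1}\bigl((M_\alpha f_1)\cdots(M_\alpha f_m)\bigr).$$ Then for all $f_j\in L^{p_j}(\mathbb{R}^n)$, $$\|\Pi_\alpha^{(m)}(f_1,\dots,f_m)\|_{L^p}\le\prod_{j=1}^m\|f_j\|_{L^{p_j}}.$$ Assume further that $\sigma(\xi_1,\dots,\xi_m)$ is a classical Coifman--Meyer symbol and that the exponents $p_1,\dots,p_m,p$ are in the range in which the associated multilinear Fourier multiplier $T_\sigma$ satisfies $$\|T_\sigma(g_1,\dots,g_m)\|_{L^p}\le C_{\sigma,p_1,\dots,p_m}\prod_{j=1}^m\|g_j\|_{L^{p_j}}$$ for all $g_1,\dots,g_m$. Define $$T_{\sigma,\alpha}(f_1,\dots,f_m):=M_\alpha^{-1}T_\sigma(M_\alpha f_1,\dots,M_\alpha f_m).$$ Then, with the same constant, for all $f_1,\dots,f_m$, $$\|T_{\sigma,\alpha}(f_1,\dots,f_m)\|_{L^p}\le C_{\sigma,p_1,\dots,p_m}\prod_{j=1}^m\|f_j\|_{L^{p_j}}.$$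
   Context: $M_\alpha f(x)=e^{i\pi|x|^2\cot\alpha}f(x)$ and $M_\alpha^{-1}$ is multiplication by $e^{-i\pi|x|^2\cot\alpha}$. A Coifman--Meyer symbol is a bounded function $\sigma$, smooth on $(\mathbb{R}^n)^m\setminus\{0\}$, with $|\partial^{\beta}\sigma(\xi_1,\dots,\xi_m)|\le C_\beta(|\xi_1|+\cdots+|\xi_m|)^{-|\beta|}$ for multi-indices $\beta$. The associated multilinear Fourier multiplier is $$T_\sigma(g_1,\dots,g_m)(x)=\int_{(\mathbb{R}^n)^m}\sigma(\xi_1,\dots,\xi_m)\,\widehat{g_1}(\xi_1)\cdots\widehat{g_m}(\xi_m)\,e^{2\pi ix\cdot(\xi_1+\cdots+\xi_m)}\,d\xi_1\cdots d\xi_m,$$ where $\widehat g(\xi)=\int_{\mathbb{R}^n}e^{-2\pi ix\cdot\xi}g(x)\,dx$. The bounds for $T_\sigma$ and $T_{\sigma,\alpha}$ are understood for Schwartz functions $g_j$, $f_j$. *)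

theory Defs
  imports "HOL-Analysis.Analysis" "HOL-Probability.Essential_Supremum"
begin

definition partial_deriv ::
  "'a::euclidean_space \<Rightarrow> ('a \<Rightarrow> 'b::real_normed_vector) \<Rightarrow> 'a \<Rightarrow> 'b" where
  "partial_deriv b f x = vector_derivative (\<lambda>t. f (x + t *\<^sub>R b)) (at 0)"

text \<open>A multi-index is encoded by a list of coordinate directions: \<open>bs \<in> lists Basis\<close> stands for the
  multi-index whose entry at \<open>b\<close> is the number of occurrences of \<open>b\<close> in \<open>bs\<close>, so its order is
  \<open>length bs\<close>. For smooth functions the order of differentiation is immaterial, so quantifying over
  all lists is the same as quantifying over all multi-indices.\<close>

primrec partial_derivs ::
  "'a::euclidean_space list \<Rightarrow> ('a \<Rightarrow> 'b::real_normed_vector) \<Rightarrow> 'a \<Rightarrow> 'b" where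
  "partial_derivs [] f = f"
| "partial_derivs (b # bs) f = partial_deriv b (partial_derivs bs f)"

text \<open>Used only for open \<open>S\<close>: iterated partial derivatives of all orders exist and are continuous
  on \<open>S\<close>.\<close>

definition smooth_on :: "'a::euclidean_space set \<Rightarrow> ('a \<Rightarrow> 'b::real_normed_vector) \<Rightarrow> bool" where
  "smooth_on S f \<longleftrightarrow>
    (\<forall>bs\<in>lists Basis. continuous_on S (partial_derivs bs f) \<and>
      (\<forall>b\<in>Basis. \<forall>x\<in>S. (\<lambda>t. partial_derivs bs f (x + t *\<^sub>R b)) differentiable at (0::real)))"

definition schwartz :: "('a::euclidean_space \<Rightarrow> complex) \<Rightarrow> bool" where
  "schwartz f \<longleftrightarrow> smooth_on UNIV f \<and>
    (\<forall>k::nat. \<forall>bs\<in>lists Basis. bounded (range (\<lambda>x. norm x ^ k *\<^sub>R partial_derivs bs f x)))"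

text \<open>The \<open>L\<^sup>p\<close> (quasi-)norm for \<open>0 < p \<le> \<infinity>\<close>, with value \<open>\<infinity>\<close> allowed. The inner case distinction
  is the power \<open>I\<^sup>1\<^sup>/\<^sup>p\<close> of an extended nonnegative real \<open>I\<close>.\<close>

definition Lp_norm :: "ennreal \<Rightarrow> ('a::euclidean_space \<Rightarrow> complex) \<Rightarrow> ennreal" where
  "Lp_norm p f =
    (if p = \<infinity> then esssup lebesgue (\<lambda>x. ennreal (norm (f x)))
     else let I = (\<integral>\<^sup>+x. ennreal (norm (f x) powr enn2real p) \<partial>lebesgue)
          in if I = \<infinity> then \<infinity> else ennreal (enn2real I powr (1 / enn2real p)))"

definition Lp_space :: "ennreal \<Rightarrow> ('a::euclidean_space \<Rightarrow> complex) set" where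
  "Lp_space p = {f. f \<in> borel_measurable lebesgue \<and> Lp_norm p f < \<infinity>}"

definition chirp_mult ::
  "real \<Rightarrow> (real^'n \<Rightarrow> complex) \<Rightarrow> real^'n \<Rightarrow> complex" where
  "chirp_mult \<alpha> f x = exp (\<i> * of_real (pi * (norm x)\<^sup>2 * cot \<alpha>)) * f x"

definition chirp_mult_inv ::
  "real \<Rightarrow> (real^'n \<Rightarrow> complex) \<Rightarrow> real^'n \<Rightarrow> complex" where
  "chirp_mult_inv \<alpha> f x = exp (- \<i> * of_real (pi * (norm x)\<^sup>2 * cot \<alpha>)) * f x"

text \<open>Families of \<open>m\<close> functions are indexed by a finite type with \<open>m\<close> elements, and points of the
  \<open>m\<close>-fold product of \<open>n\<close>-dimensional Euclidean space are elements \<open>\<xi> :: (real^'n)^'m\<close> with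
  components \<open>\<xi> $ j\<close>.\<close>

definition twisted_product ::
  "real \<Rightarrow> ('m::finite \<Rightarrow> real^'n \<Rightarrow> complex) \<Rightarrow> real^'n \<Rightarrow> complex" where
  "twisted_product \<alpha> f = chirp_mult_inv \<alpha> (\<lambda>x. \<Prod>j\<in>UNIV. chirp_mult \<alpha> (f j) x)"

definition fourier :: "(real^'n \<Rightarrow> complex) \<Rightarrow> real^'n \<Rightarrow> complex" where
  "fourier g \<xi> = (LINT x|lebesgue. exp (- 2 * of_real pi * \<i> * of_real (x \<bullet> \<xi>)) * g x)"

definition coifman_meyer_symbol :: "((real^'n)^'m \<Rightarrow> complex) \<Rightarrow> bool" where
  "coifman_meyer_symbol \<sigma> \<longleftrightarrow>
    bounded (range \<sigma>) \<and> smooth_on (- {0}) \<sigma> \<and>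
    (\<forall>bs\<in>lists Basis. \<exists>C::real. \<forall>\<xi>. \<xi> \<noteq> 0 \<longrightarrow>
      norm (partial_derivs bs \<sigma> \<xi>) \<le> C * (\<Sum>j\<in>UNIV. norm (\<xi> $ j)) powi (- int (length bs)))"

definition fourier_multiplier ::
  "((real^'n)^'m \<Rightarrow> complex) \<Rightarrow> ('m \<Rightarrow> real^'n \<Rightarrow> complex) \<Rightarrow> real^'n \<Rightarrow> complex" where
  "fourier_multiplier \<sigma> g x =
    (LINT \<xi>|lebesgue. \<sigma> \<xi> * (\<Prod>j\<in>UNIV. fourier (g j) (\<xi> $ j)) *
       exp (2 * of_real pi * \<i> * of_real (x \<bullet> (\<Sum>j\<in>UNIV. \<xi> $ j))))"

definition twisted_multiplier ::
  "real \<Rightarrow> ((real^'n)^'m \<Rightarrow> complex) \<Rightarrow> ('m \<Rightarrow> real^'n \<Rightarrow> complex) \<Rightarrow> real^'n \<Rightarrow> complex" where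
  "twisted_multiplier \<alpha> \<sigma> f =
    chirp_mult_inv \<alpha> (fourier_multiplier \<sigma> (\<lambda>j. chirp_mult \<alpha> (f j)))"

end

theory Submission
  imports Defs
begin

text \<open>The chirp has modulus one, so \<open>M\<^sub>\<alpha>\<close> and its inverse change no \<open>L\<^sup>p\<close> norm. The first estimate is
  therefore the Hoelder inequality for \<open>m\<close> factors and exponents in \<open>(0, \<infinity>]\<close>. The second is the
  assumed bound applied to \<open>M\<^sub>\<alpha> f\<^sub>j\<close>, which is again a Schwartz function because differentiating a
  chirp only produces polynomial factors.\<close>

section \<open>Hoelder's inequality for several factors\<close>

text \<open>Jensen's inequality for the convex function exp at the points \<open>ln (u i)\<close>
  with weights \<open>\<theta> i\<close>. It is the pointwise source of Hoelder's
  inequality.\<close>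

lemma weighted_arith_geom_mean:
  fixes u \<theta> :: "'i \<Rightarrow> real"
  assumes "finite I" and sum1: "sum \<theta> I = 1"
    and \<theta>: "\<And>i. i \<in> I \<Longrightarrow> 0 \<le> \<theta> i" and u: "\<And>i. i \<in> I \<Longrightarrow> 0 \<le> u i"
  shows "(\<Prod>i\<in>I. u i powr \<theta> i) \<le> (\<Sum>i\<in>I. \<theta> i * u i)"
proof (cases "\<exists>i\<in>I. u i = 0")
  case True
  \<comment> \<open>The logarithm is of no use at a zero of \<open>u\<close>. Since
    \<open>0 powr t = 0\<close> for every \<open>t\<close>, including \<open>t = 0\<close>, the
    product vanishes even if the weight at that index is zero.\<close>
  then have "(\<Prod>i\<in>I. u i powr \<theta> i) = 0"
    using \<open>finite I\<close> by auto
  then show ?thesis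
    by (simp add: sum_nonneg \<theta> u)
next
  case False
  then have pos: "0 < u i" if "i \<in> I" for i
    using u that by force
  have "I \<noteq> {}"
    using sum1 by auto
  have "exp (\<Sum>i\<in>I. \<theta> i *\<^sub>R ln (u i)) \<le> (\<Sum>i\<in>I. \<theta> i * exp (ln (u i)))"
    using convex_on_sum[OF \<open>finite I\<close> \<open>I \<noteq> {}\<close> exp_convex sum1 \<theta>, of "\<lambda>i. ln (u i)"] by simp
  also have "exp (\<Sum>i\<in>I. \<theta> i *\<^sub>R ln (u i)) = (\<Prod>i\<in>I. u i powr \<theta> i)"
    unfolding exp_sum[OF \<open>finite I\<close>] by (rule prod.cong) (auto simp: powr_def dest: pos)
  also have "(\<Sum>i\<in>I. \<theta> i * exp (ln (u i))) = (\<Sum>i\<in>I. \<theta> i * u i)"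
    by (rule sum.cong) (auto simp: pos)
  finally show ?thesis .
qed

text \<open>Hoelder's inequality for powers of functions with known integrals: divide each
  \<open>u i\<close> by its integral \<open>c i\<close>, apply the weighted mean inequality
  pointwise and integrate. The normalising constants multiply to the claimed bound.\<close>

lemma nn_integral_prod_powr_le:
  fixes u :: "'i \<Rightarrow> 'a \<Rightarrow> real" and \<theta> c :: "'i \<Rightarrow> real"
  assumes "finite I" and sum1: "sum \<theta> I = 1" and \<theta>: "\<And>i. i \<in> I \<Longrightarrow> 0 \<le> \<theta> i"
    and meas [measurable]: "\<And>i. i \<in> I \<Longrightarrow> u i \<in> borel_measurable M"
    and u: "\<And>i x. i \<in> I \<Longrightarrow> 0 \<le> u i x"
    and c: "\<And>i. i \<in> I \<Longrightarrow> 0 \<le> c i"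
    and int: "\<And>i. i \<in> I \<Longrightarrow> (\<integral>\<^sup>+x. ennreal (u i x) \<partial>M) = ennreal (c i)"
  shows "(\<integral>\<^sup>+x. ennreal (\<Prod>i\<in>I. u i x powr \<theta> i) \<partial>M) \<le> ennreal (\<Prod>i\<in>I. c i powr \<theta> i)"
proof (cases "\<exists>i\<in>I. c i = 0")
  case True
  then obtain i where i: "i \<in> I" "c i = 0" by blast
  \<comment> \<open>Division by \<open>c i\<close> is not possible here. A nonnegative function of
    integral zero vanishes almost everywhere and takes the whole product with it.\<close>
  have "AE x in M. u i x = 0"
    using int[OF i(1)] i u[OF i(1)] by (simp add: nn_integral_0_iff_AE order_antisym)
  then have "AE x in M. ennreal (\<Prod>i\<in>I. u i x powr \<theta> i) = 0"
  proof eventually_elim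
    case (elim x)
    then have "(\<Prod>i\<in>I. u i x powr \<theta> i) = 0"
      using i(1) \<open>finite I\<close> by auto
    then show ?case by simp
  qed
  then have "(\<integral>\<^sup>+x. ennreal (\<Prod>i\<in>I. u i x powr \<theta> i) \<partial>M) = (\<integral>\<^sup>+x. 0 \<partial>M)"
    by (rule nn_integral_cong_AE)
  then show ?thesis by simp
next
  case False
  then have pos: "0 < c i" if "i \<in> I" for i
    using c that by force
  define K where "K = (\<Prod>i\<in>I. c i powr \<theta> i)"
  have "K \<ge> 0"
    unfolding K_def by (simp add: prod_nonneg)
  have "(\<Prod>i\<in>I. u i x powr \<theta> i) \<le> K * (\<Sum>i\<in>I. \<theta> i * (u i x / c i))" for x
  proof -
    have "(\<Prod>i\<in>I. u i x powr \<theta> i) = K * (\<Prod>i\<in>I. (u i x / c i) powr \<theta> i)"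
      unfolding K_def prod.distrib[symmetric]
    proof (rule prod.cong)
      fix i assume "i \<in> I"
      then show "u i x powr \<theta> i = c i powr \<theta> i * (u i x / c i) powr \<theta> i"
        using pos[of i] u[of i x] by (simp flip: powr_mult)
    qed simp
    also have "\<dots> \<le> K * (\<Sum>i\<in>I. \<theta> i * (u i x / c i))"
      by (intro mult_left_mono weighted_arith_geom_mean)
        (use assms \<open>K \<ge> 0\<close> in \<open>auto simp: divide_nonneg_nonneg\<close>)
    finally show ?thesis .
  qed
  then have "(\<integral>\<^sup>+x. ennreal (\<Prod>i\<in>I. u i x powr \<theta> i) \<partial>M)
      \<le> (\<integral>\<^sup>+x. ennreal (K * (\<Sum>i\<in>I. \<theta> i * (u i x / c i))) \<partial>M)"
    by (intro nn_integral_mono ennreal_leI) simp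
  also have "\<dots> = (\<integral>\<^sup>+x. ennreal K * (\<Sum>i\<in>I. ennreal (\<theta> i / c i) * ennreal (u i x)) \<partial>M)"
  proof (intro nn_integral_cong)
    fix x
    have "(\<Sum>i\<in>I. ennreal (\<theta> i / c i) * ennreal (u i x)) = (\<Sum>i\<in>I. ennreal (\<theta> i * (u i x / c i)))"
      by (rule sum.cong) (auto simp: ennreal_mult''[symmetric] u)
    also have "\<dots> = ennreal (\<Sum>i\<in>I. \<theta> i * (u i x / c i))"
      by (rule sum_ennreal) (simp add: \<theta> u c)
    finally show "ennreal (K * (\<Sum>i\<in>I. \<theta> i * (u i x / c i)))
        = ennreal K * (\<Sum>i\<in>I. ennreal (\<theta> i / c i) * ennreal (u i x))"
      using \<open>K \<ge> 0\<close> by (simp add: ennreal_mult')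
  qed
  also have "\<dots> = ennreal K * (\<Sum>i\<in>I. ennreal (\<theta> i / c i) * ennreal (c i))"
    by (simp add: nn_integral_cmult nn_integral_sum int)
  \<comment> \<open>Each normalised function \<open>u i / c i\<close> has integral one, so only the
    weights remain, and these sum to one.\<close>
  also have "(\<Sum>i\<in>I. ennreal (\<theta> i / c i) * ennreal (c i)) = (\<Sum>i\<in>I. ennreal (\<theta> i))"
    by (intro sum.cong refl) (use pos in \<open>force simp: ennreal_mult''[symmetric]\<close>)
  also have "\<dots> = 1"
    using sum1 \<theta> by (simp add: sum_ennreal)
  finally show ?thesis
    by (simp add: K_def)
qed

section \<open>Passing between \<open>Lp_norm\<close> and the integral or essential supremum behind
  it\<close>

lemma Lp_norm_top_AE: "AE x in lebesgue. ennreal (norm (f x)) \<le> Lp_norm \<infinity> f"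
  using esssup_AE[where M = lebesgue and f = "\<lambda>x. ennreal (norm (f x))"] by (simp add: Lp_norm_def)

text \<open>Finiteness excludes the infinite branch of \<open>Lp_norm\<close>. The integral is then
  a real number \<open>c\<close>, and later computations can use real powers.\<close>

lemma Lp_norm_finite_exponent:
  assumes "p \<noteq> \<infinity>" "Lp_norm p f < \<infinity>"
  obtains c where "0 \<le> c" "(\<integral>\<^sup>+x. ennreal (norm (f x) powr enn2real p) \<partial>lebesgue) = ennreal c"
    "Lp_norm p f = ennreal (c powr (1 / enn2real p))"
proof (cases "\<integral>\<^sup>+x. ennreal (norm (f x) powr enn2real p) \<partial>lebesgue")
  case (real c)
  with assms that[of c] show ?thesis
    by (simp add: Lp_norm_def Let_def)
next
  case top
  with assms show ?thesis
    by (simp add: Lp_norm_def Let_def)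
qed

text \<open>The bound makes the integral finite, and taking the root of order
  \<open>enn2real p\<close>, which is monotone on nonnegative reals, undoes the power of
  \<open>b\<close>.\<close>

lemma Lp_norm_le_if_nn_integral_le:
  assumes "0 < p" "p \<noteq> \<infinity>" "0 \<le> b"
    and le: "(\<integral>\<^sup>+x. ennreal (norm (f x) powr enn2real p) \<partial>lebesgue) \<le> ennreal (b powr enn2real p)"
  shows "Lp_norm p f \<le> ennreal b"
proof -
  have p: "0 < enn2real p"
    using assms by (simp add: enn2real_positive_iff less_top)
  show ?thesis
  proof (cases "\<integral>\<^sup>+x. ennreal (norm (f x) powr enn2real p) \<partial>lebesgue")
    case (real c)
    then have "c \<le> b powr enn2real p"
      using le by (simp add: ennreal_le_iff)
    then have "c powr (1 / enn2real p) \<le> (b powr enn2real p) powr (1 / enn2real p)"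
      using real p by (intro powr_mono2) auto
    also have "\<dots> = b"
      using p \<open>0 \<le> b\<close> by (simp add: powr_powr)
    finally show ?thesis
      using real \<open>p \<noteq> \<infinity>\<close> by (simp add: Lp_norm_def Let_def ennreal_leI)
  next
    case top
    then show ?thesis
      using le by (simp add: top_unique)
  qed
qed

lemma ennreal_one_divide:
  assumes "0 < p" "p \<noteq> \<infinity>"
  shows "1 / p = ennreal (1 / enn2real p)"
  using assms by (cases p) (auto simp: divide_ennreal simp flip: ennreal_1)

text \<open>Factors with infinite exponent are bounded almost everywhere and leave the integral as
  constants. For the others, indexed by \<open>J\<close>, the weights \<open>r / q i\<close> sum to
  one, so the previous integral inequality applies to the powers
  \<open>norm (f i x) powr q i\<close>. The size of \<open>r\<close> does not matter, so
  \<open>P\<close> below one is covered.\<close>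

lemma Lp_norm_prod_le:
  fixes f :: "'i \<Rightarrow> 'a::euclidean_space \<Rightarrow> complex"
  assumes "finite I" and P: "0 < P" and sum: "1 / P = (\<Sum>i\<in>I. 1 / p i)"
    and f: "\<And>i. i \<in> I \<Longrightarrow> f i \<in> Lp_space (p i)"
  shows "Lp_norm P (\<lambda>x. \<Prod>i\<in>I. f i x) \<le> (\<Prod>i\<in>I. Lp_norm (p i) (f i))"
proof -
  define J where "J = {i \<in> I. p i \<noteq> \<infinity>}"
  have "J \<subseteq> I" and "finite J"
    using \<open>finite I\<close> by (auto simp: J_def)
  have meas [measurable]: "f i \<in> borel_measurable lebesgue" if "i \<in> I" for i
    using f[OF that] by (simp add: Lp_space_def)
  have fin: "Lp_norm (p i) (f i) < \<infinity>" if "i \<in> I" for i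
    using f[OF that] by (simp add: Lp_space_def)
  define N where "N i = enn2real (Lp_norm (p i) (f i))" for i
  have N: "Lp_norm (p i) (f i) = ennreal (N i)" if "i \<in> I" for i
    using fin[OF that] by (simp add: N_def)
  have N0: "0 \<le> N i" for i
    by (simp add: N_def)
  have prodN: "(\<Prod>i\<in>I. Lp_norm (p i) (f i)) = ennreal (\<Prod>i\<in>I. N i)"
    by (simp add: N N0 prod_ennreal)
  \<comment> \<open>In \<open>ennreal\<close>, \<open>1 / 0\<close> is \<open>\<infinity>\<close>: a
    zero exponent would make the sum infinite, while \<open>1 / P\<close> is finite.\<close>
  have p0: "0 < p i" if "i \<in> I" for i
  proof (rule ccontr)
    assume "\<not> 0 < p i"
    then have "(\<Sum>i\<in>I. 1 / p i) = \<infinity>"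
      using that \<open>finite I\<close> by (force simp: ennreal_divide_zero)
    then show False
      using sum P by (simp add: ennreal_divide_eq_top_iff)
  qed
  have AE_I_minus_J: "AE x in lebesgue. \<forall>i\<in>I - J. norm (f i x) \<le> N i"
  proof (rule AE_finite_allI)
    fix i assume "i \<in> I - J"
    then have "p i = \<infinity>" "i \<in> I"
      by (auto simp: J_def)
    then show "AE x in lebesgue. norm (f i x) \<le> N i"
      using Lp_norm_top_AE[of "f i"] N[of i] N0[of i] by (simp add: ennreal_le_iff)
  qed (use \<open>finite I\<close> in auto)
  show ?thesis
  proof (cases "P = \<infinity>")
    case True
    \<comment> \<open>Now \<open>1 / P = 0\<close>, so every reciprocal in the sum is zero and every
      exponent is infinite.\<close>
    have "J = {}"
    proof (rule ccontr)
      assume "J \<noteq> {}"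
      then obtain i where "i \<in> I" "p i \<noteq> \<infinity>"
        by (auto simp: J_def)
      moreover have "1 / p i = 0"
        using sum True \<open>i \<in> I\<close> \<open>finite I\<close> by simp
      ultimately show False
        by (auto simp: ennreal_divide_eq_0_iff)
    qed
    have "AE x in lebesgue. ennreal (norm (\<Prod>i\<in>I. f i x)) \<le> ennreal (\<Prod>i\<in>I. N i)"
      using AE_I_minus_J
    proof eventually_elim
      case (elim x)
      then show ?case
        unfolding prod_norm[symmetric] using \<open>J = {}\<close>
        by (intro ennreal_leI prod_mono) auto
    qed
    then show ?thesis
      unfolding prodN by (simp add: Lp_norm_def True esssup_I)
  next
    case False
    define r where "r = enn2real P"
    define q where "q i = enn2real (p i)" for i
    have r: "0 < r"
      using P False by (simp add: r_def enn2real_positive_iff less_top)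
    have q: "0 < q i" if "i \<in> J" for i
      using that p0[of i] by (simp add: q_def J_def enn2real_positive_iff less_top)
    \<comment> \<open>The exponent identity is moved from \<open>ennreal\<close> to the reals.
      Indices outside \<open>J\<close> drop out because \<open>1 / \<infinity> = 0\<close>.\<close>
    have "ennreal (1 / r) = (\<Sum>i\<in>I. 1 / p i)"
      using sum ennreal_one_divide[OF P False] by (simp add: r_def)
    also have "\<dots> = (\<Sum>i\<in>J. 1 / p i)"
      by (rule sum.mono_neutral_right) (use \<open>finite I\<close> in \<open>auto simp: J_def\<close>)
    also have "\<dots> = (\<Sum>i\<in>J. ennreal (1 / q i))"
      by (rule sum.cong) (use p0 in \<open>auto simp: J_def q_def ennreal_one_divide\<close>)
    also have "\<dots> = ennreal (\<Sum>i\<in>J. 1 / q i)"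
      by (rule sum_ennreal) (use q in force)
    finally have "1 / r = (\<Sum>i\<in>J. 1 / q i)"
      using r q by (subst (asm) ennreal_inj) (auto intro!: sum_nonneg simp: less_imp_le)
    then have sum1: "(\<Sum>i\<in>J. r / q i) = 1"
      using r sum_distrib_left[of r "\<lambda>i. 1 / q i" J] by (simp flip: \<open>1 / r = _\<close>)
    have "\<exists>c. 0 \<le> c \<and> (\<integral>\<^sup>+x. ennreal (norm (f i x) powr q i) \<partial>lebesgue) = ennreal c
        \<and> N i = c powr (1 / q i)" if "i \<in> J" for i
    proof -
      from that have i: "i \<in> I" "p i \<noteq> \<infinity>"
        by (auto simp: J_def)
      show ?thesis
        using Lp_norm_finite_exponent[OF i(2) fin[OF i(1)]] unfolding q_def N_def
        by (metis enn2real_ennreal powr_ge_zero)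
    qed
    then obtain c where c: "\<And>i. i \<in> J \<Longrightarrow> 0 \<le> c i"
      "\<And>i. i \<in> J \<Longrightarrow> (\<integral>\<^sup>+x. ennreal (norm (f i x) powr q i) \<partial>lebesgue) = ennreal (c i)"
      "\<And>i. i \<in> J \<Longrightarrow> N i = c i powr (1 / q i)"
      by metis
    \<comment> \<open>\<open>L\<close> bounds the \<open>r\<close>-th power of the product of all
      factors with infinite exponent, almost everywhere.\<close>
    define L where "L = (\<Prod>i\<in>I - J. N i powr r)"
    have "L \<ge> 0"
      by (simp add: L_def prod_nonneg)
    have "(\<integral>\<^sup>+x. ennreal (norm (\<Prod>i\<in>I. f i x) powr r) \<partial>lebesgue)
        \<le> (\<integral>\<^sup>+x. ennreal L * ennreal (\<Prod>i\<in>J. (norm (f i x) powr q i) powr (r / q i)) \<partial>lebesgue)"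
    proof (rule nn_integral_mono_AE)
      show "AE x in lebesgue. ennreal (norm (\<Prod>i\<in>I. f i x) powr r)
          \<le> ennreal L * ennreal (\<Prod>i\<in>J. (norm (f i x) powr q i) powr (r / q i))"
        using AE_I_minus_J
      proof eventually_elim
        case (elim x)
        have "norm (\<Prod>i\<in>I. f i x) powr r = (\<Prod>i\<in>I. norm (f i x) powr r)"
          by (simp add: prod_norm[symmetric] prod_powr_distrib)
        also have "\<dots> = (\<Prod>i\<in>I - J. norm (f i x) powr r) * (\<Prod>i\<in>J. norm (f i x) powr r)"
          by (rule prod.subset_diff) fact+
        also have "\<dots> \<le> L * (\<Prod>i\<in>J. norm (f i x) powr r)"
          unfolding L_def
          by (intro mult_right_mono prod_mono) (use elim r in \<open>auto intro!: powr_mono2 prod_nonneg\<close>)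
        \<comment> \<open>This puts the integrand into the shape of
          \<open>nn_integral_prod_powr_le\<close>, with functions
          \<open>norm (f i x) powr q i\<close> of integral \<open>c i\<close> and weights
          \<open>r / q i\<close>.\<close>
        also have "(\<Prod>i\<in>J. norm (f i x) powr r)
            = (\<Prod>i\<in>J. (norm (f i x) powr q i) powr (r / q i))"
          by (rule prod.cong) (use q in \<open>force simp: powr_powr\<close>)+
        finally show ?case
          using \<open>L \<ge> 0\<close> by (simp add: ennreal_mult'[symmetric] ennreal_leI)
      qed
    qed
    also have "\<dots> = ennreal L
        * (\<integral>\<^sup>+x. ennreal (\<Prod>i\<in>J. (norm (f i x) powr q i) powr (r / q i)) \<partial>lebesgue)"
    proof (rule nn_integral_cmult)
      have [measurable]: "f i \<in> borel_measurable lebesgue" if "i \<in> J" for i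
        using that \<open>J \<subseteq> I\<close> meas by blast
      show "(\<lambda>x. ennreal (\<Prod>i\<in>J. (norm (f i x) powr q i) powr (r / q i))) \<in> borel_measurable lebesgue"
        by measurable
    qed
    also have "\<dots> \<le> ennreal L * ennreal (\<Prod>i\<in>J. c i powr (r / q i))"
      by (intro mult_left_mono nn_integral_prod_powr_le)
        (use \<open>J \<subseteq> I\<close> \<open>finite J\<close> c q r sum1 in \<open>auto simp: less_imp_le\<close>)
    also have "\<dots> = ennreal (L * (\<Prod>i\<in>J. N i powr r))"
    proof -
      have "(\<Prod>i\<in>J. c i powr (r / q i)) = (\<Prod>i\<in>J. N i powr r)"
        by (rule prod.cong) (auto simp: c(3) powr_powr)
      then show ?thesis
        using \<open>L \<ge> 0\<close> by (simp add: ennreal_mult')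
    qed
    also have "L * (\<Prod>i\<in>J. N i powr r) = (\<Prod>i\<in>I. N i powr r)"
      unfolding L_def by (rule prod.subset_diff[symmetric]) fact+
    also have "\<dots> = (\<Prod>i\<in>I. N i) powr r"
      by (simp add: N0 prod_powr_distrib)
    finally show ?thesis
      unfolding prodN r_def
      by (intro Lp_norm_le_if_nn_integral_le) (use P False N0 in \<open>auto intro: prod_nonneg\<close>)
  qed
qed

section \<open>Schwartz functions\<close>

lemma partial_derivs_append: "partial_derivs (bs @ cs) f = partial_derivs bs (partial_derivs cs f)"
  by (induction bs) simp_all

text \<open>The decay condition of \<open>schwartz\<close> for the empty list of directions only.
  Decay of the derivatives is recovered through \<open>schwartz_coinduct\<close>.\<close>

definition rapidly_decreasing :: "('a::euclidean_space \<Rightarrow> complex) \<Rightarrow> bool" where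
  "rapidly_decreasing f \<longleftrightarrow> (\<forall>k::nat. bounded (range (\<lambda>x. norm x ^ k *\<^sub>R f x)))"

lemma rapidly_decreasing_bound:
  assumes "rapidly_decreasing f"
  obtains B where "\<And>x. norm x ^ k * norm (f x) \<le> B"
  using assms unfolding rapidly_decreasing_def bounded_iff by (auto simp: norm_power)

lemma rapidly_decreasingI:
  assumes "\<And>k. \<exists>B. \<forall>x. norm x ^ k * norm (f x) \<le> B"
  shows "rapidly_decreasing f"
  using assms unfolding rapidly_decreasing_def bounded_iff by (auto simp: norm_power)

lemma rapidly_decreasing_add:
  assumes "rapidly_decreasing f" "rapidly_decreasing g"
  shows "rapidly_decreasing (\<lambda>x. f x + g x)"
proof (rule rapidly_decreasingI)
  fix k
  obtain A B where "\<And>x. norm x ^ k * norm (f x) \<le> A" "\<And>x. norm x ^ k * norm (g x) \<le> B"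
    using assms by (metis rapidly_decreasing_bound)
  then have "norm x ^ k * norm (f x + g x) \<le> A + B" for x
    using mult_left_mono[OF norm_triangle_ineq[of "f x" "g x"], of "norm x ^ k"]
    by (smt (verit) distrib_left norm_ge_zero zero_le_power)
  then show "\<exists>B. \<forall>x. norm x ^ k * norm (f x + g x) \<le> B"
    by blast
qed

text \<open>By Cauchy-Schwarz a linear factor costs one power of \<open>norm x\<close>, so the bound
  for \<open>Suc k\<close> controls the order \<open>k\<close>.\<close>

lemma rapidly_decreasing_inner_mult:
  assumes "rapidly_decreasing f"
  shows "rapidly_decreasing (\<lambda>x. of_real (x \<bullet> c) * f x)"
proof (rule rapidly_decreasingI)
  fix k
  obtain B where B: "\<And>x. norm x ^ Suc k * norm (f x) \<le> B"
    using assms by (metis rapidly_decreasing_bound)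
  have "norm x ^ k * norm (of_real (x \<bullet> c) * f x) \<le> norm c * B" for x
  proof -
    have "norm x ^ k * norm (of_real (x \<bullet> c) * f x) \<le> norm x ^ k * ((norm x * norm c) * norm (f x))"
      unfolding norm_mult norm_of_real
      by (intro mult_left_mono mult_right_mono Cauchy_Schwarz_ineq2) auto
    also have "\<dots> = norm c * (norm x ^ Suc k * norm (f x))"
      by (simp add: ac_simps)
    also have "\<dots> \<le> norm c * B"
      by (intro mult_left_mono B) simp
    finally show ?thesis .
  qed
  then show "\<exists>B. \<forall>x. norm x ^ k * norm (of_real (x \<bullet> c) * f x) \<le> B"
    by blast
qed

lemma rapidly_decreasing_unimodular_mult:
  assumes "rapidly_decreasing f" "\<And>x. norm (e x) = 1"
  shows "rapidly_decreasing (\<lambda>x. e x * f x)"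
  using assms by (simp add: rapidly_decreasing_def bounded_iff norm_mult)

lemma rapidly_decreasing_cmult:
  assumes "rapidly_decreasing f"
  shows "rapidly_decreasing (\<lambda>x. a * f x)"
proof (rule rapidly_decreasingI)
  fix k
  obtain B where B: "\<And>x. norm x ^ k * norm (f x) \<le> B"
    using assms by (metis rapidly_decreasing_bound)
  have "norm x ^ k * norm (a * f x) \<le> norm a * B" for x
    using mult_left_mono[OF B[of x], of "norm a"] by (simp add: norm_mult ac_simps)
  then show "\<exists>B. \<forall>x. norm x ^ k * norm (a * f x) \<le> B"
    by blast
qed

section \<open>Schwartz functions and their partial derivatives\<close>

lemma schwartz_imp_continuous: "schwartz f \<Longrightarrow> continuous_on UNIV f"
  unfolding schwartz_def smooth_on_def by (metis lists.Nil partial_derivs.simps(1))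

lemma schwartz_imp_rapidly_decreasing: "schwartz f \<Longrightarrow> rapidly_decreasing f"
  unfolding schwartz_def rapidly_decreasing_def by (metis lists.Nil partial_derivs.simps(1))

text \<open>\<open>partial_derivs\<close> applies the last entry of its list first, so
  differentiating \<open>f\<close> beforehand amounts to appending \<open>b\<close> at the end of
  the list.\<close>

lemma schwartz_partial_deriv:
  assumes "schwartz f" "b \<in> Basis"
  shows "schwartz (partial_deriv b f)"
proof -
  have "bs @ [b] \<in> lists Basis" if "bs \<in> lists Basis" for bs
    using that assms(2) by simp
  moreover have "partial_derivs bs (partial_deriv b f) = partial_derivs (bs @ [b]) f" for bs
    by (simp add: partial_derivs_append)
  ultimately show ?thesis
    using assms(1) unfolding schwartz_def smooth_on_def by metis
qed

lemma schwartz_has_partial_deriv: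
  assumes "schwartz f" "b \<in> Basis"
  shows "((\<lambda>t. f (x + t *\<^sub>R b)) has_vector_derivative partial_deriv b f x) (at 0)"
proof -
  have "(\<lambda>t. f (x + t *\<^sub>R b)) differentiable at (0::real)"
    using assms unfolding schwartz_def smooth_on_def
    by (metis UNIV_I lists.Nil partial_derivs.simps(1))
  then show ?thesis
    unfolding partial_deriv_def by (simp add: vector_derivative_works)
qed

lemma partial_deriv_eqI:
  assumes "\<And>x. ((\<lambda>t. f (x + t *\<^sub>R b)) has_vector_derivative g x) (at 0)"
  shows "partial_deriv b f = g"
  unfolding partial_deriv_def using assms by (auto intro: vector_derivative_at)

text \<open>Coinduction principle: it reduces closure properties of the Schwartz space to one
  differentiation, without any Leibniz formula for iterated derivatives.\<close>

lemma schwartz_coinduct: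
  assumes "X f"
    and cont: "\<And>f. X f \<Longrightarrow> continuous_on UNIV f"
    and decr: "\<And>f. X f \<Longrightarrow> rapidly_decreasing f"
    and deriv: "\<And>f b. X f \<Longrightarrow> b \<in> Basis \<Longrightarrow>
      \<exists>g. X g \<and> (\<forall>x. ((\<lambda>t. f (x + t *\<^sub>R b)) has_vector_derivative g x) (at 0))"
  shows "schwartz f"
proof -
  \<comment> \<open>Derivatives are unique, so the witness supplied by \<open>deriv\<close> is the
    actual partial derivative and \<open>X\<close> passes along the list.\<close>
  have X: "X (partial_derivs bs f)" if "bs \<in> lists Basis" for bs
    using that
  proof induction
    case Nil
    then show ?case using \<open>X f\<close> by simp
  next
    case (Cons b bs)
    then show ?case
      using deriv partial_deriv_eqI by (metis partial_derivs.simps(2))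
  qed
  show ?thesis
    unfolding schwartz_def smooth_on_def
  proof (intro conjI ballI allI)
    fix bs :: "'a list" assume bs: "bs \<in> lists Basis"
    show "continuous_on UNIV (partial_derivs bs f)"
      using cont X bs by blast
    show "bounded (range (\<lambda>x. norm x ^ k *\<^sub>R partial_derivs bs f x))" for k
      using decr X bs by (auto simp: rapidly_decreasing_def)
    show "(\<lambda>t. partial_derivs bs f (x + t *\<^sub>R b)) differentiable at (0::real)"
      if "b \<in> Basis" for b x
      using deriv[OF X[OF bs] that] by (blast intro: differentiableI_vector)
  qed
qed

section \<open>Closure properties of the Schwartz space\<close>

lemma schwartz_add:
  assumes "schwartz f" "schwartz g"
  shows "schwartz (\<lambda>x. f x + g x)"
proof -
  define X where "X h \<longleftrightarrow> (\<exists>f g. schwartz f \<and> schwartz g \<and> h = (\<lambda>x. f x + g x))"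
    for h :: "'a \<Rightarrow> complex"
  have "X (\<lambda>x. f x + g x)"
    using assms by (auto simp: X_def)
  then show ?thesis
  proof (rule schwartz_coinduct[where X = X])
    fix h assume "X h"
    then show "continuous_on UNIV h"
      by (auto simp: X_def intro!: continuous_intros intro: schwartz_imp_continuous)
    show "rapidly_decreasing h"
      using \<open>X h\<close>
      by (auto simp: X_def intro!: rapidly_decreasing_add intro: schwartz_imp_rapidly_decreasing)
    fix b :: 'a assume b: "b \<in> Basis"
    from \<open>X h\<close> obtain f g where fg: "schwartz f" "schwartz g" "h = (\<lambda>x. f x + g x)"
      by (auto simp: X_def)
    with b show "\<exists>g. X g \<and> (\<forall>x. ((\<lambda>t. h (x + t *\<^sub>R b)) has_vector_derivative g x) (at 0))"
      by (intro exI[of _ "\<lambda>x. partial_deriv b f x + partial_deriv b g x"])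
        (auto simp: X_def intro!: schwartz_partial_deriv has_vector_derivative_add schwartz_has_partial_deriv)
  qed
qed

lemma schwartz_cmult:
  assumes "schwartz f"
  shows "schwartz (\<lambda>x. a * f x)"
proof -
  define X where "X h \<longleftrightarrow> (\<exists>f. schwartz f \<and> h = (\<lambda>x. a * f x))"
    for h :: "'a \<Rightarrow> complex"
  have "X (\<lambda>x. a * f x)"
    using assms by (auto simp: X_def)
  then show ?thesis
  proof (rule schwartz_coinduct[where X = X])
    fix h assume "X h"
    then show "continuous_on UNIV h"
      by (auto simp: X_def intro!: continuous_intros intro: schwartz_imp_continuous)
    show "rapidly_decreasing h"
      using \<open>X h\<close>
      by (auto simp: X_def intro!: rapidly_decreasing_cmult intro: schwartz_imp_rapidly_decreasing)
    fix b :: 'a assume b: "b \<in> Basis"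
    from \<open>X h\<close> obtain f where f: "schwartz f" "h = (\<lambda>x. a * f x)"
      by (auto simp: X_def)
    with b show "\<exists>g. X g \<and> (\<forall>x. ((\<lambda>t. h (x + t *\<^sub>R b)) has_vector_derivative g x) (at 0))"
      by (intro exI[of _ "\<lambda>x. a * partial_deriv b f x"])
        (auto simp: X_def intro!: schwartz_partial_deriv has_vector_derivative_mult_right
            schwartz_has_partial_deriv)
  qed
qed

lemma schwartz_inner_mult:
  assumes "schwartz f"
  shows "schwartz (\<lambda>x. of_real (x \<bullet> c) * f x)"
proof -
  \<comment> \<open>Products alone are not closed under differentiation, since the derivative of the
    linear factor leaves a multiple of \<open>f\<close>. The extra Schwartz summand absorbs
    it.\<close>
  define X where "X h \<longleftrightarrow> (\<exists>f g. schwartz f \<and> schwartz g \<and> h = (\<lambda>x. of_real (x \<bullet> c) * f x + g x))"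
    for h :: "'a \<Rightarrow> complex"
  \<comment> \<open>This provides the zero function as the initial extra summand.\<close>
  have "schwartz (\<lambda>x. 0 * f x)"
    by (rule schwartz_cmult) fact
  then have "X (\<lambda>x. of_real (x \<bullet> c) * f x)"
    using assms unfolding X_def by (intro exI[of _ f] exI[of _ "\<lambda>x. 0"]) auto
  then show ?thesis
  proof (rule schwartz_coinduct[where X = X])
    fix h assume "X h"
    then show "continuous_on UNIV h"
      by (auto simp: X_def intro!: continuous_intros intro: schwartz_imp_continuous)
    show "rapidly_decreasing h"
      using \<open>X h\<close>
      by (auto simp: X_def intro!: rapidly_decreasing_add rapidly_decreasing_inner_mult
          intro: schwartz_imp_rapidly_decreasing)
    fix b :: 'a assume b: "b \<in> Basis"
    from \<open>X h\<close> obtain f g where fg: "schwartz f" "schwartz g" "h = (\<lambda>x. of_real (x \<bullet> c) * f x + g x)"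
      by (auto simp: X_def)
    \<comment> \<open>\<open>k\<close> is the new extra summand: the term from differentiating
      \<open>x \<bullet> c\<close>, plus the derivative of the old summand \<open>g\<close>.\<close>
    define k where "k x = of_real (b \<bullet> c) * f x + partial_deriv b g x" for x
    have "schwartz k"
      unfolding k_def by (intro schwartz_add schwartz_cmult schwartz_partial_deriv fg b)
    have inner: "((\<lambda>t. of_real ((x + t *\<^sub>R b) \<bullet> c) :: complex) has_vector_derivative of_real (b \<bullet> c)) (at 0)" for x
      by (auto intro!: derivative_eq_intros has_vector_derivative_of_real simp: inner_left_distrib)
    have "((\<lambda>t. h (x + t *\<^sub>R b)) has_vector_derivative of_real (x \<bullet> c) * partial_deriv b f x + k x) (at 0)" for x
      using has_vector_derivative_add[OF has_vector_derivative_mult[OF inner[of x]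
          schwartz_has_partial_deriv[OF fg(1) b, of x]] schwartz_has_partial_deriv[OF fg(2) b, of x]]
      by (simp add: fg(3) k_def algebra_simps)
    moreover have "X (\<lambda>x. of_real (x \<bullet> c) * partial_deriv b f x + k x)"
      using \<open>schwartz k\<close> schwartz_partial_deriv[OF fg(1) b] by (auto simp: X_def)
    ultimately show "\<exists>g. X g \<and> (\<forall>x. ((\<lambda>t. h (x + t *\<^sub>R b)) has_vector_derivative g x) (at 0))"
      by blast
  qed
qed

text \<open>Differentiating the phase \<open>e\<close> reproduces it times a linear factor. The
  functions \<open>e\<close> times a Schwartz function are thus closed under differentiation, by
  \<open>schwartz_inner_mult\<close>, and decay is kept because \<open>e\<close> has modulus
  one.\<close>

lemma schwartz_gaussian_phase_mult:
  fixes f :: "'a::euclidean_space \<Rightarrow> complex" and c :: real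
  assumes "schwartz f"
  shows "schwartz (\<lambda>x. exp (\<i> * of_real (c * (norm x)\<^sup>2)) * f x)"
proof -
  define e where "e x = exp (\<i> * of_real (c * (norm x)\<^sup>2))" for x :: 'a
  have norm_e: "norm (e x) = 1" for x
    by (simp add: e_def)
  have e_deriv: "((\<lambda>t. e (x + t *\<^sub>R b)) has_vector_derivative 2 * \<i> * of_real (c * (x \<bullet> b)) * e x) (at 0)"
    for x b
  proof -
    \<comment> \<open>The squared norm is written as an inner product, which is a quadratic
      polynomial in \<open>t\<close>.\<close>
    have "((\<lambda>t. c * ((x + t *\<^sub>R b) \<bullet> (x + t *\<^sub>R b))) has_vector_derivative c * (2 * (x \<bullet> b))) (at 0)"
      by (auto intro!: derivative_eq_intros simp: inner_commute has_real_derivative_iff_has_vector_derivative[symmetric]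
          inner_left_distrib inner_right_distrib)
    then have "((\<lambda>t. \<i> * of_real (c * ((x + t *\<^sub>R b) \<bullet> (x + t *\<^sub>R b)))) has_vector_derivative
        \<i> * of_real (c * (2 * (x \<bullet> b)))) (at 0)"
      by (intro has_vector_derivative_mult_right[OF has_vector_derivative_of_real])
        (simp add: has_real_derivative_iff_has_vector_derivative)
    from field_vector_diff_chain_at[OF this DERIV_exp] show ?thesis
      by (simp add: o_def e_def power2_norm_eq_inner algebra_simps)
  qed
  define X where "X h \<longleftrightarrow> (\<exists>f. schwartz f \<and> h = (\<lambda>x. e x * f x))"
    for h :: "'a \<Rightarrow> complex"
  have "X (\<lambda>x. e x * f x)"
    using assms by (auto simp: X_def)
  then have "schwartz (\<lambda>x. e x * f x)"
  proof (rule schwartz_coinduct[where X = X])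
    fix h assume "X h"
    then show "continuous_on UNIV h"
      by (auto simp: X_def e_def intro!: continuous_intros intro: schwartz_imp_continuous)
    show "rapidly_decreasing h"
      using \<open>X h\<close>
      by (auto simp: X_def norm_e intro!: rapidly_decreasing_unimodular_mult intro: schwartz_imp_rapidly_decreasing)
    fix b :: 'a assume b: "b \<in> Basis"
    from \<open>X h\<close> obtain f where f: "schwartz f" "h = (\<lambda>x. e x * f x)"
      by (auto simp: X_def)
    \<comment> \<open>The product rule for \<open>e x * f x\<close> with the common factor
      \<open>e x\<close> taken out.\<close>
    define k where "k x = 2 * \<i> * of_real c * (of_real (x \<bullet> b) * f x) + partial_deriv b f x" for x
    have "schwartz k"
      unfolding k_def
      by (intro schwartz_add schwartz_cmult schwartz_inner_mult schwartz_partial_deriv f b)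
    moreover have "((\<lambda>t. h (x + t *\<^sub>R b)) has_vector_derivative e x * k x) (at 0)" for x
      using has_vector_derivative_mult[OF e_deriv[of x b] schwartz_has_partial_deriv[OF f(1) b, of x]]
      by (simp add: f(2) k_def algebra_simps)
    ultimately show "\<exists>g. X g \<and> (\<forall>x. ((\<lambda>t. h (x + t *\<^sub>R b)) has_vector_derivative g x) (at 0))"
      by (auto simp: X_def)
  qed
  then show ?thesis
    by (simp add: e_def)
qed

section \<open>Chirp multiplication\<close>

lemma schwartz_chirp_mult: "schwartz f \<Longrightarrow> schwartz (chirp_mult \<alpha> f)"
  using schwartz_gaussian_phase_mult[of f "pi * cot \<alpha>"]
  by (simp add: chirp_mult_def[abs_def] mult.assoc mult.left_commute mult.commute)

lemma norm_chirp_mult: "norm (chirp_mult \<alpha> f x) = norm (f x)"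
  unfolding chirp_mult_def norm_mult norm_exp_i_times by simp

lemma norm_chirp_mult_inv: "norm (chirp_mult_inv \<alpha> f x) = norm (f x)"
  using norm_exp_i_times[of "- (pi * (norm x)\<^sup>2 * cot \<alpha>)"]
  unfolding chirp_mult_inv_def norm_mult by simp

text \<open>\<open>Lp_norm\<close> is built from the modulus alone, so unimodular factors drop out
  of it.\<close>

lemma Lp_norm_cong: "(\<And>x. norm (f x) = norm (g x)) \<Longrightarrow> Lp_norm p f = Lp_norm p g"
  by (simp add: Lp_norm_def)

lemma Lp_norm_chirp_mult: "Lp_norm p (chirp_mult \<alpha> f) = Lp_norm p f"
  by (rule Lp_norm_cong) (rule norm_chirp_mult)

lemma Lp_norm_chirp_mult_inv: "Lp_norm p (chirp_mult_inv \<alpha> f) = Lp_norm p f"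
  by (rule Lp_norm_cong) (rule norm_chirp_mult_inv)

text \<open>The modulus is multiplicative, so every chirp disappears and the untwisted product
  remains, to which \<open>Lp_norm_prod_le\<close> applies.\<close>

lemma Lp_norm_twisted_product: "Lp_norm p (twisted_product \<alpha> f) = Lp_norm p (\<lambda>x. \<Prod>j\<in>UNIV. f j x)"
  unfolding twisted_product_def Lp_norm_chirp_mult_inv
  by (rule Lp_norm_cong) (simp add: prod_norm[symmetric] norm_chirp_mult)

theorem theorem12p5:
  fixes \<alpha> :: real and p :: "'m::finite \<Rightarrow> ennreal" and P :: ennreal
  assumes "\<nexists>k::int. \<alpha> = of_int k * pi"
    and "CARD('m) \<ge> 2"
    and "\<And>j. 1 \<le> p j"
    and "0 < P"
    and "1 / P = (\<Sum>j\<in>UNIV. 1 / p j)"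
  shows "(\<forall>f :: 'm \<Rightarrow> real^'n \<Rightarrow> complex. (\<forall>j. f j \<in> Lp_space (p j)) \<longrightarrow>
            Lp_norm P (twisted_product \<alpha> f) \<le> (\<Prod>j\<in>UNIV. Lp_norm (p j) (f j)))
       \<and> (\<forall>(\<sigma> :: (real^'n)^'m \<Rightarrow> complex) (C::real).
            coifman_meyer_symbol \<sigma> \<and> 0 \<le> C \<and>
            (\<forall>g. (\<forall>j. schwartz (g j)) \<longrightarrow>
               Lp_norm P (fourier_multiplier \<sigma> g) \<le> ennreal C * (\<Prod>j\<in>UNIV. Lp_norm (p j) (g j)))
            \<longrightarrow>
            (\<forall>f. (\<forall>j. schwartz (f j)) \<longrightarrow>
               Lp_norm P (twisted_multiplier \<alpha> \<sigma> f) \<le> ennreal C * (\<Prod>j\<in>UNIV. Lp_norm (p j) (f j))))"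
proof (intro conjI allI impI)
  fix f :: "'m \<Rightarrow> real^'n \<Rightarrow> complex"
  assume "\<forall>j. f j \<in> Lp_space (p j)"
  then show "Lp_norm P (twisted_product \<alpha> f) \<le> (\<Prod>j\<in>UNIV. Lp_norm (p j) (f j))"
    unfolding Lp_norm_twisted_product by (intro Lp_norm_prod_le assms) auto
next
  fix \<sigma> :: "(real^'n)^'m \<Rightarrow> complex" and C :: real and f :: "'m \<Rightarrow> real^'n \<Rightarrow> complex"
  assume bound: "coifman_meyer_symbol \<sigma> \<and> 0 \<le> C \<and>
      (\<forall>g. (\<forall>j. schwartz (g j)) \<longrightarrow>
        Lp_norm P (fourier_multiplier \<sigma> g) \<le> ennreal C * (\<Prod>j\<in>UNIV. Lp_norm (p j) (g j)))"
    and f: "\<forall>j. schwartz (f j)"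
  \<comment> \<open>The bound for the multiplier is available on Schwartz functions only, so the
    chirped inputs must be shown to be admissible.\<close>
  have "schwartz (chirp_mult \<alpha> (f j))" for j
    using f by (simp add: schwartz_chirp_mult)
  then have "Lp_norm P (fourier_multiplier \<sigma> (\<lambda>j. chirp_mult \<alpha> (f j)))
      \<le> ennreal C * (\<Prod>j\<in>UNIV. Lp_norm (p j) (chirp_mult \<alpha> (f j)))"
    using bound[THEN conjunct2, THEN conjunct2, rule_format, of "\<lambda>j. chirp_mult \<alpha> (f j)"] by blast
  then show "Lp_norm P (twisted_multiplier \<alpha> \<sigma> f) \<le> ennreal C * (\<Prod>j\<in>UNIV. Lp_norm (p j) (f j))"
    by (simp add: twisted_multiplier_def Lp_norm_chirp_mult Lp_norm_chirp_mult_inv)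
qed

end
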